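(* Let $d\ge1$ be an integer, $p>d$ real, and $q=0$. Then there is a unique non-negative solution $u_{c,\infty}$ of the free boundary problem $$(|u'|^{p-2}u')'+\frac{d-1}{r}|u'|^{p-2}u'=1\quad(0<r<R),\qquad u(0)=1,\quad u(R)=u'(R)=0,$$ and it has the closed form $$u_{c,\infty}(r)=d^{-\frac{p}{p-1}}R^{\frac{p}{p-1}}\left(\mathcal{B}\Big(\frac{p-d}{d(p-1)},\frac{p}{p-1}\Big)-B\Big(\Big(\frac rR\Big)^d;\frac{p-d}{d(p-1)},\frac{p}{p-1}\Big)\right)\quad(0\le r\le R),$$ $$R=d\left(\mathcal{B}\Big(\frac{p-d}{d(p-1)},\frac{p}{p-1}\Big)\right)^{-\frac{p-1}{p}}.$$
   Context: The free boundary point $R\in(0,\infty)$ is part of the unknown; $u>0$ on $[0,R)$, $'=d/dr$, and $u(0)=1$ means $\lim_{r\to0^+}u(r)=1$. $B(x;a,b)=\int_0^x t^{a-1}(1-t)^{b-1}\,dt$ is the incomplete Beta function and $\mathcal{B}(a,b)=B(1;a,b)$ is the Beta function. *)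

theory Defs
  imports "HOL-Analysis.Analysis"
begin

text \<open>The one-dimensional \<open>p\<close>-Laplacian flux \<open>|s|\<^sup>p\<^sup>-\<^sup>2 s\<close>. Its value at \<open>s = 0\<close> is \<open>0\<close> for every
  \<open>p > 1\<close>, also when \<open>p \<le> 2\<close>, because \<open>0 powr a = 0\<close>; this is the continuous extension.\<close>

definition p_flux :: "real \<Rightarrow> real \<Rightarrow> real" where
  "p_flux p s = \<bar>s\<bar> powr (p - 2) * s"

text \<open>A pair \<open>(u, R)\<close>, with \<open>u\<close> regarded as a function on \<open>[0, R]\<close>; its values outside that interval
  are irrelevant. The condition \<open>u(0) = 1\<close> is the one-sided limit, and the value of \<open>u\<close> at \<open>0\<close> is
  taken to be that limit. The derivative at \<open>R\<close> is the one-sided one. Apart from that the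
  equation is classical: \<open>u\<close> and the flux of \<open>u'\<close> are differentiable on \<open>(0, R)\<close>.\<close>

definition free_boundary_solution :: "nat \<Rightarrow> real \<Rightarrow> (real \<Rightarrow> real) \<Rightarrow> real \<Rightarrow> bool" where
  "free_boundary_solution d p u R \<longleftrightarrow>
     0 < R \<and>
     (\<forall>r\<in>{0..<R}. 0 < u r) \<and>
     (\<forall>r\<in>{0<..<R}.
        u differentiable (at r) \<and>
        (\<lambda>s. p_flux p (deriv u s)) differentiable (at r) \<and>
        deriv (\<lambda>s. p_flux p (deriv u s)) r + (real d - 1) / r * p_flux p (deriv u r) = 1) \<and>
     u 0 = 1 \<and> (u \<longlongrightarrow> 1) (at_right 0) \<and>
     u R = 0 \<and> (u has_real_derivative 0) (at R within {0..R})"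

definition incomplete_Beta :: "real \<Rightarrow> real \<Rightarrow> real \<Rightarrow> real" where
  "incomplete_Beta x a b = integral {0..x} (\<lambda>t. t powr (a - 1) * (1 - t) powr (b - 1))"

lemma incomplete_Beta_1:
  assumes "0 < a" "0 < b"
  shows "incomplete_Beta 1 a b = Beta a b"
  unfolding incomplete_Beta_def
  using has_integral_Beta_real[OF assms] by (rule integral_unique)

end

theory Submission
  imports Defs
begin

text \<open>Multiplying the equation by \<open>r\<^sup>d\<^sup>-\<^sup>1\<close> gives \<open>(r\<^sup>d\<^sup>-\<^sup>1 \<phi>)' = r\<^sup>d\<^sup>-\<^sup>1\<close> for the flux \<open>\<phi>\<close> of
  \<open>u'\<close>. The conditions at \<open>R\<close> force \<open>\<phi>\<close> to tend to \<open>0\<close> there, so \<open>\<phi> = - (R\<^sup>d - r\<^sup>d) / (d r\<^sup>d\<^sup>-\<^sup>1)\<close>, and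
  inverting the flux determines \<open>u'\<close>. The substitution \<open>t = (r / R)\<^sup>d\<close> turns the
  integral of \<open>u'\<close> into an incomplete Beta function, and \<open>u(0) = 1\<close> fixes \<open>R\<close>.\<close>

text \<open>Minus the flux of the solution with free boundary at \<open>R\<close>. This sign makes
  it positive on \<open>(0, R)\<close>, so real powers invert the flux.\<close>

definition flux_gap :: "nat \<Rightarrow> real \<Rightarrow> real \<Rightarrow> real" where
  "flux_gap d R r = (R ^ d - r ^ d) / (real d * r ^ (d - 1))"

text \<open>\<open>R\<close> stays a free parameter: the value 1 at \<open>0\<close> is not built in
  and later serves as the equation for \<open>R\<close>.\<close>

definition profile :: "nat \<Rightarrow> real \<Rightarrow> real \<Rightarrow> real \<Rightarrow> real" where
  "profile d p R r = real d powr (- (p / (p - 1))) * R powr (p / (p - 1)) *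
     (Beta ((p - real d) / (real d * (p - 1))) (p / (p - 1)) -
      incomplete_Beta ((r / R) ^ d) ((p - real d) / (real d * (p - 1))) (p / (p - 1)))"

section \<open>Inverting the flux\<close>

lemma p_flux_uminus_powr:
  assumes "1 < p" "0 \<le> y"
  shows "p_flux p (- (y powr (1 / (p - 1)))) = - y"
proof (cases "y = 0")
  case False
  then have y: "0 < y" using assms by simp
  have "y powr (1 / (p - 1) * (p - 2)) * y powr (1 / (p - 1)) = y powr 1"
    unfolding powr_add[symmetric] using assms by (intro arg_cong2[where f="(powr)"]) (auto simp: field_simps)
  then show ?thesis using y by (simp add: p_flux_def powr_powr)
qed (simp add: p_flux_def)

text \<open>The flux keeps the sign of \<open>s\<close> and has modulus |s|^(p-1), so it is
  injective. Uniqueness uses this to recover the derivative from the flux.\<close>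

lemma p_flux_inverse:
  assumes "1 < p"
  shows "s = sgn (p_flux p s) * \<bar>p_flux p s\<bar> powr (1 / (p - 1))"
proof (cases "s = 0")
  case False
  have "\<bar>p_flux p s\<bar> = \<bar>s\<bar> powr (p - 2) * \<bar>s\<bar> powr 1"
    using False by (simp add: p_flux_def abs_mult)
  also have "\<dots> = \<bar>s\<bar> powr (p - 1)" unfolding powr_add[symmetric] by simp
  finally have "\<bar>p_flux p s\<bar> powr (1 / (p - 1)) = \<bar>s\<bar>"
    using assms False by (simp add: powr_powr)
  moreover have "sgn (p_flux p s) = sgn s"
    using False by (simp add: p_flux_def sgn_mult)
  ultimately show ?thesis by (simp add: sgn_mult_abs)
qed (simp add: p_flux_def)

text \<open>Unlike \<open>DERIV_power\<close>, this form avoids the truncated exponent \<open>k - 1\<close>.\<close>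

lemma DERIV_power_quotient:
  assumes "0 < (r :: real)"
  shows "((\<lambda>r. r ^ k) has_real_derivative real k * r ^ k / r) (at r)"
  using DERIV_pow[of k r] assms by (cases k) auto

section \<open>Regularity of the incomplete Beta function\<close>

lemma Beta_integrand_integrable:
  fixes a b :: real
  assumes "0 < a" "0 < b"
  shows "(\<lambda>t. t powr (a - 1) * (1 - t) powr (b - 1)) integrable_on {0..1}"
  using has_integral_Beta_real[OF assms] by (rule has_integral_integrable)

lemma continuous_on_incomplete_Beta:
  assumes "0 < a" "0 < b"
  shows "continuous_on {0..1} (\<lambda>x. incomplete_Beta x a b)"
  unfolding incomplete_Beta_def
  by (rule indefinite_integral_continuous_1[OF Beta_integrand_integrable[OF assms]])

text \<open>Since \<open>1 < b\<close>, the integrand is continuous even at \<open>t = 1\<close>, so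
  the endpoint matching \<open>r = R\<close> is covered. At \<open>x = 0\<close> it is singular when
  \<open>a < 1\<close>.\<close>

lemma incomplete_Beta_has_real_derivative:
  assumes "0 < a" "1 < b" "0 < x" "x \<le> 1"
  shows "((\<lambda>x. incomplete_Beta x a b) has_real_derivative x powr (a - 1) * (1 - x) powr (b - 1))
    (at x within {0..1})"
proof -
  have "continuous (at x within {0..1}) (\<lambda>t. t powr (a - 1) * (1 - t) powr (b - 1))"
    unfolding continuous_within using assms
    by (intro tendsto_intros) (auto simp: eventually_at_filter)
  then show ?thesis
    unfolding incomplete_Beta_def has_real_derivative_iff_has_vector_derivative
    using integral_has_vector_derivative_continuous_at[of _ 0 1 x "{}"]
      Beta_integrand_integrable[of a b] assms by auto
qed

section \<open>The closed-form profile and its derivative\<close>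

context
  fixes d :: nat and p R :: real
  assumes d: "1 \<le> d" and p: "real d < p" and R: "0 < R"
begin

lemma p_gt_1: "1 < p"
  using d p by linarith

lemma Beta_args: "0 < (p - real d) / (real d * (p - 1))" "1 < p / (p - 1)"
  using d p p_gt_1 by (auto simp: field_simps)

lemma ratio_power_Icc:
  assumes "0 \<le> r" "r \<le> R"
  shows "0 \<le> (r / R) ^ d" "(r / R) ^ d \<le> 1"
  using assms R by (auto intro!: power_le_one simp del: power_divide simp: divide_le_eq_1)

text \<open>Exhibits the flux as the member with \<open>C = R ^ d / real d\<close> of the family
  found in \<open>flux_first_integral\<close>.\<close>

lemma flux_gap_eq: "0 < r \<Longrightarrow> - flux_gap d R r = r / real d - R ^ d / real d / r ^ (d - 1)"
  using d by (cases d) (auto simp: flux_gap_def diff_divide_distrib simp del: of_nat_Suc)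

lemma flux_gap_pos: "0 < r \<Longrightarrow> r < R \<Longrightarrow> 0 < flux_gap d R r"
  using d by (auto simp: flux_gap_def power_strict_mono)

text \<open>The left side is what the chain rule yields for the Beta term of \<open>profile\<close>.
  At \<open>r = R\<close> both sides are 0; for \<open>r < R\<close> all factors are positive and
  the logarithms are compared.\<close>

lemma flux_gap_eq_profile_rate:
  assumes "0 < r" "r \<le> R"
  defines "t \<equiv> (r / R) ^ d"
  shows "real d powr (- (p / (p - 1))) * R powr (p / (p - 1)) *
    (t powr ((p - real d) / (real d * (p - 1)) - 1) * (1 - t) powr (p / (p - 1) - 1) *
     (real d * (r / R) ^ (d - 1) / R)) = flux_gap d R r powr (1 / (p - 1))"
proof (cases "r = R")
  case True
  have "p / (p - 1) - 1 = 1 / (p - 1)" using p_gt_1 by (simp add: field_simps)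
  then show ?thesis using True R p_gt_1 by (simp add: t_def flux_gap_def)
next
  case False
  then have rR: "r < R" "0 < r / R" "r / R < 1" using assms by auto
  have t: "0 < t" "t < 1" unfolding t_def using rR d by (auto simp: power_less_one_iff)
  have lnt: "ln t = real d * (ln r - ln R)"
    unfolding t_def using rR assms R by (simp add: ln_realpow ln_div)
  have gap: "flux_gap d R r = R ^ d * (1 - t) / (real d * r ^ (d - 1))"
  proof -
    have "R ^ d * (1 - t) = R ^ d - r ^ d"
      using R by (simp add: t_def power_divide right_diff_distrib)
    then show ?thesis by (simp add: flux_gap_def)
  qed
  have lngap: "ln (flux_gap d R r) = real d * ln R + ln (1 - t) - ln d - (real d - 1) * ln r"
    unfolding gap using R assms t d
    by (simp add: ln_div ln_mult ln_realpow of_nat_diff)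
  have lnpow: "ln ((r / R) ^ (d - 1)) = (real d - 1) * (ln r - ln R)"
    using rR assms R d by (simp add: ln_realpow ln_div of_nat_diff)
  have "real d powr (- (p / (p - 1))) * R powr (p / (p - 1)) *
    (t powr ((p - real d) / (real d * (p - 1)) - 1) * (1 - t) powr (p / (p - 1) - 1) *
     (real d * (r / R) ^ (d - 1) / R)) = exp (- (p / (p - 1)) * ln d + p / (p - 1) * ln R +
      (((p - real d) / (real d * (p - 1)) - 1) * ln t + (p / (p - 1) - 1) * ln (1 - t) +
      (ln d + ln ((r / R) ^ (d - 1)) - ln R)))"
    using d R t rR by (simp add: powr_def exp_add exp_diff exp_minus divide_inverse)
  \<comment> \<open>Both sides are linear in \<open>ln d\<close>, \<open>ln R\<close>,
    \<open>ln r\<close> and \<open>ln (1 - t)\<close>, with equal coefficients.\<close>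
  also have "- (p / (p - 1)) * ln d + p / (p - 1) * ln R +
      (((p - real d) / (real d * (p - 1)) - 1) * ln t + (p / (p - 1) - 1) * ln (1 - t) +
      (ln d + ln ((r / R) ^ (d - 1)) - ln R)) = 1 / (p - 1) * ln (flux_gap d R r)"
    unfolding lnt lngap lnpow using p_gt_1 d by (simp add: divide_simps) (simp add: algebra_simps)
  also have "exp \<dots> = flux_gap d R r powr (1 / (p - 1))"
    using flux_gap_pos[of r] rR assms by (simp add: powr_def)
  finally show ?thesis .
qed

text \<open>Including \<open>r = R\<close> yields the free boundary condition, because
  \<open>flux_gap\<close> vanishes there.\<close>

lemma profile_has_real_derivative:
  assumes "0 < r" "r \<le> R"
  shows "(profile d p R has_real_derivative - (flux_gap d R r powr (1 / (p - 1))))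
    (at r within {0..R})"
proof -
  have t: "0 < (r / R) ^ d" "(r / R) ^ d \<le> 1"
    using assms ratio_power_Icc by auto
  have sub: "(\<lambda>r. (r / R) ^ d) ` {0..R} \<subseteq> {0..1}"
    using ratio_power_Icc by auto
  have "((\<lambda>r. incomplete_Beta ((r / R) ^ d) ((p - real d) / (real d * (p - 1))) (p / (p - 1)))
    has_real_derivative
     ((r / R) ^ d) powr ((p - real d) / (real d * (p - 1)) - 1) *
     (1 - (r / R) ^ d) powr (p / (p - 1) - 1) *
     (real d * (r / R) ^ (d - 1) / R)) (at r within {0..R})"
    \<comment> \<open>The chain rule wants the outer derivative within the image of
      \<open>{0..R}\<close>, hence the restriction by \<open>sub\<close>.\<close>
    by (rule DERIV_image_chain[unfolded o_def, where g="\<lambda>r. (r / R) ^ d",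
          OF DERIV_subset[OF incomplete_Beta_has_real_derivative[OF Beta_args t] sub]])
      (use R in \<open>auto intro!: derivative_eq_intros\<close>)
  then show ?thesis
    unfolding profile_def[abs_def] flux_gap_eq_profile_rate[OF assms, symmetric]
    using R by (auto intro!: derivative_eq_intros)
qed

lemma continuous_on_profile: "continuous_on {0..R} (profile d p R)"
proof -
  have "continuous_on {0..R} (\<lambda>r. incomplete_Beta ((r / R) ^ d)
      ((p - real d) / (real d * (p - 1))) (p / (p - 1)))"
    by (rule continuous_on_compose2[OF continuous_on_incomplete_Beta])
      (use Beta_args ratio_power_Icc R in \<open>auto intro!: continuous_intros\<close>)
  then show ?thesis
    unfolding profile_def[abs_def] by (intro continuous_intros)
qed

lemma profile_R: "profile d p R R = 0"
  using R Beta_args by (simp add: profile_def incomplete_Beta_1)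

lemma profile_0: "profile d p R 0 = (R / real d) powr (p / (p - 1)) *
    Beta ((p - real d) / (real d * (p - 1))) (p / (p - 1))"
  using R d by (simp add: profile_def incomplete_Beta_def powr_divide powr_minus
      power_0_left field_simps)

lemma profile_deriv:
  assumes "0 < r" "r < R"
  shows "(profile d p R has_real_derivative - (flux_gap d R r powr (1 / (p - 1)))) (at r)"
  using profile_has_real_derivative[of r] assms by (simp add: at_within_Icc_at)

text \<open>The profile decreases strictly to its value 0 at \<open>R\<close>; continuity up to the
  left end covers \<open>r = 0\<close>.\<close>

lemma profile_pos:
  assumes "0 \<le> r" "r < R"
  shows "0 < profile d p R r"
proof -
  have "profile d p R R < profile d p R r"
  proof (rule DERIV_neg_imp_decreasing_open[OF assms(2)])
    fix s assume "r < s" "s < R"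
    then have s: "0 < s" "s < R" using assms by auto
    show "\<exists>y. (profile d p R has_real_derivative y) (at s) \<and> y < 0"
      using profile_deriv[OF s] flux_gap_pos[OF s] by auto
  next
    show "continuous_on {r..R} (profile d p R)"
      using assms by (intro continuous_on_subset[OF continuous_on_profile]) auto
  qed
  then show ?thesis by (simp add: profile_R)
qed

lemma profile_p_flux:
  assumes "0 < r" "r < R"
  shows "p_flux p (deriv (profile d p R) r) = - flux_gap d R r"
  using DERIV_imp_deriv[OF profile_deriv[OF assms]] p_flux_uminus_powr[OF p_gt_1]
    flux_gap_pos[OF assms] by simp

section \<open>The profile solves the equation\<close>

lemma flux_gap_deriv:
  assumes "0 < r"
  shows "((\<lambda>r. - flux_gap d R r) has_real_derivative
    1 - (real d - 1) / r * - flux_gap d R r) (at r)"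
proof -
  \<comment> \<open>With \<open>r ^ d = r * K\<close> the claim becomes a rational identity free of
    truncated exponents.\<close>
  define K where "K = r ^ (d - 1)"
  have K: "0 < K" and rK: "r ^ d = r * K"
    unfolding K_def using assms d by (simp, cases d) auto
  have "((\<lambda>r. - flux_gap d R r) has_real_derivative
      - (((0 - real d * r ^ d / r) * (real d * r ^ (d - 1)) -
          (R ^ d - r ^ d) * (real d * (real (d - 1) * r ^ (d - 1) / r))) /
         (real d * r ^ (d - 1) * (real d * r ^ (d - 1))))) (at r)"
    unfolding flux_gap_def using assms d
    by (intro DERIV_minus DERIV_divide DERIV_diff DERIV_const DERIV_cmult DERIV_power_quotient)
      auto
  moreover have "0 < real d" "real (d - 1) = real d - 1"
    using d by auto
  then have "- (((0 - real d * r ^ d / r) * (real d * r ^ (d - 1)) -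
          (R ^ d - r ^ d) * (real d * (real (d - 1) * r ^ (d - 1) / r))) /
         (real d * r ^ (d - 1) * (real d * r ^ (d - 1)))) =
      1 - (real d - 1) / r * - flux_gap d R r"
    unfolding flux_gap_def K_def[symmetric] rK using K assms
    by (simp add: divide_simps) (simp add: algebra_simps)
  ultimately show ?thesis by (rule DERIV_cong)
qed

lemma profile_solution:
  assumes "profile d p R 0 = 1"
  shows "free_boundary_solution d p (profile d p R) R"
proof -
  have flux: "((\<lambda>s. p_flux p (deriv (profile d p R) s)) has_real_derivative
      1 - (real d - 1) / r * - flux_gap d R r) (at r)" if "0 < r" "r < R" for r
    \<comment> \<open>The flux equals \<open>- flux_gap\<close> only on \<open>(0, R)\<close>, which
      is open and so suffices for the derivative.\<close>
    by (rule has_field_derivative_transform_within_open[OF flux_gap_deriv, where S="{0<..<R}"])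
      (use that profile_p_flux in auto)
  have lim: "(profile d p R \<longlongrightarrow> 1) (at_right 0)"
    using continuous_on_Icc_at_rightD[OF continuous_on_profile R] assms by simp
  have "(profile d p R has_real_derivative 0) (at R within {0..R})"
    using profile_has_real_derivative[of R] R by (simp add: flux_gap_def)
  then show ?thesis
    unfolding free_boundary_solution_def
  proof (intro conjI ballI)
    fix r assume "r \<in> {0<..<R}"
    then have r: "0 < r" "r < R" by auto
    show "profile d p R differentiable at r"
      using profile_deriv[OF r] by (auto simp: real_differentiable_def)
    show "(\<lambda>s. p_flux p (deriv (profile d p R) s)) differentiable at r"
      using flux[OF r] by (auto simp: real_differentiable_def)
    show "deriv (\<lambda>s. p_flux p (deriv (profile d p R) s)) r +
        (real d - 1) / r * p_flux p (deriv (profile d p R) r) = 1"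
      by (simp add: DERIV_imp_deriv[OF flux[OF r]] profile_p_flux[OF r])
  qed (use R profile_pos lim assms profile_R in auto)
qed

section \<open>Uniqueness for fixed radius\<close>

lemma flux_first_integral:
  fixes \<phi> :: "real \<Rightarrow> real"
  assumes "\<And>r. 0 < r \<Longrightarrow> r < R \<Longrightarrow>
    (\<phi> has_real_derivative 1 - (real d - 1) / r * \<phi> r) (at r)"
  obtains C where "\<And>r. 0 < r \<Longrightarrow> r < R \<Longrightarrow> \<phi> r = r / real d - C / r ^ (d - 1)"
proof -
  \<comment> \<open>The integrating factor \<open>r ^ (d - 1)\<close> turns the equation into
    constancy of \<open>h\<close>; its value is \<open>C\<close>.\<close>
  define h where "h r = r ^ d / real d - r ^ (d - 1) * \<phi> r" for r
  have "(h has_real_derivative 0) (at r)" if r: "0 < r" "r < R" for r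
  proof -
    have "(h has_real_derivative real d * r ^ d / r / real d -
        ((real (d - 1) * r ^ (d - 1) / r) * \<phi> r +
         (1 - (real d - 1) / r * \<phi> r) * r ^ (d - 1))) (at r)"
      unfolding h_def
      by (intro DERIV_diff DERIV_mult DERIV_cdivide DERIV_power_quotient assms r)
    moreover have "real d * r ^ d / r / real d = r ^ (d - 1)"
      using r d by (cases d) auto
    ultimately show ?thesis
      using d by (simp add: of_nat_diff algebra_simps)
  qed
  then have "h constant_on {0<..<R}"
    by (intro has_field_derivative_0_imp_constant_on)
      (auto intro: has_field_derivative_at_within)
  then obtain C where C: "\<And>r. 0 < r \<Longrightarrow> r < R \<Longrightarrow> h r = C"
    unfolding constant_on_def by auto
  show thesis
  proof (rule that[of C])
    fix r assume r: "0 < r" "r < R"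
    show "\<phi> r = r / real d - C / r ^ (d - 1)"
      unfolding C[OF r, symmetric] h_def using r d
      by (cases d) (auto simp: diff_divide_distrib simp del: of_nat_Suc)
  qed
qed

text \<open>The first integral leaves one constant, and the zero slope at \<open>R\<close> fixes
  it.\<close>

lemma solution_deriv:
  assumes v: "free_boundary_solution d p v R" and r: "0 < r" "r < R"
  shows "(v has_real_derivative - (flux_gap d R r powr (1 / (p - 1)))) (at r)"
proof -
  define \<phi> where "\<phi> r = p_flux p (deriv v r)" for r
  have diff: "(v has_real_derivative deriv v r) (at r)" if "0 < r" "r < R" for r
    using v that by (auto simp: free_boundary_solution_def DERIV_deriv_iff_real_differentiable)
  have "(\<phi> has_real_derivative 1 - (real d - 1) / r * \<phi> r) (at r)" if "0 < r" "r < R" for r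
  proof -
    have "\<phi> differentiable (at r)" "deriv \<phi> r + (real d - 1) / r * \<phi> r = 1"
      using v that by (auto simp: free_boundary_solution_def \<phi>_def[abs_def])
    then show ?thesis
      by (metis DERIV_deriv_iff_real_differentiable add_diff_cancel_right')
  qed
  then obtain C where C: "\<And>r. 0 < r \<Longrightarrow> r < R \<Longrightarrow> \<phi> r = r / real d - C / r ^ (d - 1)"
    using flux_first_integral by blast
  define g where "g y = sgn y * \<bar>y\<bar> powr (1 / (p - 1))" for y :: real
  have deriv_v: "deriv v r = g (\<phi> r)" for r
    unfolding g_def \<phi>_def by (rule p_flux_inverse[OF p_gt_1])
  have near: "\<forall>\<^sub>F r in at_left R. r \<in> {0<..<R}"
    using R by (intro eventually_at_left_real)
  define L where "L = R / real d - C / R ^ (d - 1)"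
  have "((\<lambda>r. r / real d - C / r ^ (d - 1)) \<longlongrightarrow> L) (at_left R)"
    unfolding L_def using R d by (intro tendsto_intros) auto
  then have \<phi>_lim: "(\<phi> \<longlongrightarrow> L) (at_left R)"
    by (rule Lim_transform_eventually) (use near C in \<open>auto elim!: eventually_mono\<close>)
  text \<open>By l'Hopital's rule the one-sided derivative at \<open>R\<close> is the limit of \<open>v'\<close>.\<close>
  have "L = 0"
  proof (rule ccontr)
    assume L: "L \<noteq> 0"
    \<comment> \<open>\<open>sgn\<close> is continuous only away from 0, so
      \<open>L \<noteq> 0\<close> is what allows passing to the limit in \<open>g\<close>.\<close>
    then have "((\<lambda>r. deriv v r) \<longlongrightarrow> g L) (at_left R)"
      unfolding deriv_v g_def using \<phi>_lim by (intro tendsto_intros) auto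
    then have deriv_lim: "((\<lambda>r. deriv v r / 1) \<longlongrightarrow> g L) (at_left R)" by simp
    have quot: "((\<lambda>r. (v r - v R) / (r - R)) \<longlongrightarrow> 0) (at R within {0..R})"
      using v by (auto simp: free_boundary_solution_def has_field_derivative_iff)
    have cont: "(v \<longlongrightarrow> v R) (at R within {0..R})"
      using v DERIV_continuous unfolding continuous_within[symmetric] free_boundary_solution_def
      by blast
    have left: "at R within {0..R} = at_left R"
      using R by (simp add: at_within_Icc_at_left)
    have "((\<lambda>r. v r / (r - R)) \<longlongrightarrow> g L) (at_left R)"
    proof (rule lhopital_left[OF _ _ _ _ _ _ deriv_lim])
      show "(v \<longlongrightarrow> 0) (at_left R)"
        using cont v unfolding left free_boundary_solution_def by simp
      show "((\<lambda>r. r - R) \<longlongrightarrow> 0) (at_left R)"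
        by (auto intro!: tendsto_eq_intros)
      show "\<forall>\<^sub>F r in at_left R. (v has_real_derivative deriv v r) (at r)"
        using near diff by (auto elim!: eventually_mono)
      show "\<forall>\<^sub>F r in at_left R. r - R \<noteq> 0"
        using near by (auto elim!: eventually_mono)
    qed (auto intro!: always_eventually derivative_eq_intros)
    moreover have "((\<lambda>r. v r / (r - R)) \<longlongrightarrow> 0) (at_left R)"
      using quot v unfolding left free_boundary_solution_def by simp
    ultimately have "g L = 0"
      by (rule tendsto_unique[OF trivial_limit_at_left_real])
    then show False using L by (simp add: g_def sgn_eq_0_iff)
  qed
  then have "C = R ^ d / real d"
    using R d by (cases d) (auto simp: L_def field_simps simp del: of_nat_Suc)
  then have "\<phi> r = - flux_gap d R r"
    using C[OF r] flux_gap_eq[OF r(1)] by simp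
  then show ?thesis
    using diff[OF r] flux_gap_pos[OF r] by (simp add: deriv_v g_def)
qed

text \<open>Both functions have the same derivative and vanish at \<open>R\<close>. Matching them at
  \<open>R\<close> rather than at \<open>0\<close> leaves \<open>v 0 = 1\<close> available to
  determine the radius.\<close>

lemma solution_eq_profile:
  assumes v: "free_boundary_solution d p v R"
  shows "\<forall>r\<in>{0..R}. v r = profile d p R r"
proof -
  have v0: "v 0 = 1" "(v \<longlongrightarrow> 1) (at_right 0)" and vR: "v R = 0"
    "(v has_real_derivative 0) (at R within {0..R})"
    using v by (auto simp: free_boundary_solution_def)
  have "(v \<longlongrightarrow> v R) (at R within {0..R})"
    using DERIV_continuous[OF vR(2)] by (simp add: continuous_within)
  then have "(v \<longlongrightarrow> v R) (at_left R)"
    using R by (simp add: at_within_Icc_at_left)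
  moreover have "isCont v r" if "0 < r" "r < R" for r
    using solution_deriv[OF v that] by (rule DERIV_isCont)
  \<comment> \<open>At \<open>0\<close> this rests on the one-sided limit agreeing with
    \<open>v 0 = 1\<close>.\<close>
  ultimately have "continuous_on {0..R} v"
    using v0 R by (intro continuous_on_IccI) (auto simp: isCont_def)
  then have cont: "continuous_on {0..R} (\<lambda>r. v r - profile d p R r)"
    by (intro continuous_intros continuous_on_profile)
  have der: "((\<lambda>r. v r - profile d p R r) has_real_derivative 0) (at r)" if "0 < r" "r < R" for r
    using DERIV_diff[OF solution_deriv[OF v that] profile_deriv[OF that]] by simp
  show ?thesis
  proof
    fix r assume r: "r \<in> {0..R}"
    have "v r - profile d p R r = v 0 - profile d p R 0" if "r \<in> {0..R}" for r
      by (rule DERIV_isconst2[OF R cont der]) (use that in auto)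
    from this[OF r] this[of R] show "v r = profile d p R r"
      using R vR profile_R by simp
  qed
qed

end

section \<open>Determination of the radius\<close>

theorem proposition4p1:
  fixes d :: nat and p :: real
  assumes "1 \<le> d" and "real d < p"
  shows "\<exists>u R.
    free_boundary_solution d p u R \<and>
    (\<forall>v S. free_boundary_solution d p v S \<longrightarrow> S = R \<and> (\<forall>r\<in>{0..R}. v r = u r)) \<and>
    (\<forall>r\<in>{0..R}. u r =
       real d powr (- (p / (p - 1))) * R powr (p / (p - 1)) *
       (Beta ((p - real d) / (real d * (p - 1))) (p / (p - 1)) -
        incomplete_Beta ((r / R) ^ d) ((p - real d) / (real d * (p - 1))) (p / (p - 1)))) \<and>
    R = real d * Beta ((p - real d) / (real d * (p - 1))) (p / (p - 1)) powr (- ((p - 1) / p))"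
proof -
  define q where "q = p / (p - 1)"
  define B where "B = Beta ((p - real d) / (real d * (p - 1))) q"
  define R where "R = real d * B powr (- ((p - 1) / p))"
  \<comment> \<open>\<open>zero_less_one\<close> instantiates the radius of the context with 1; the
    actual \<open>R\<close> is built from \<open>B\<close>, whose positivity must come
    first.\<close>
  have p1: "1 < p" and q: "1 < q"
    using p_gt_1[OF assms] Beta_args[OF assms zero_less_one] by (auto simp: q_def)
  have B: "0 < B"
    unfolding B_def Beta_def using Beta_args[OF assms zero_less_one] q
    by (auto intro!: divide_pos_pos mult_pos_pos Gamma_real_pos add_pos_pos)
  have R: "0 < R"
    using assms B by (simp add: R_def)
  \<comment> \<open>By \<open>profile_0\<close> the left equation says that the profile of radius
    \<open>S\<close> equals 1 at \<open>0\<close>. It has a single positive root, which gives both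
    existence and uniqueness of \<open>R\<close>.\<close>
  have normalized: "(S / real d) powr q * B = 1 \<longleftrightarrow> S = R" if "0 < S" for S
  proof -
    have inv: "B powr (- ((p - 1) / p)) = (1 / B) powr (1 / q)"
      using B by (simp add: q_def powr_minus powr_divide field_simps)
    have "(S / real d) powr q * B = 1 \<longleftrightarrow> (S / real d) powr q = 1 / B"
      using B by (simp add: field_simps)
    also have "\<dots> \<longleftrightarrow> S / real d = (1 / B) powr (1 / q)"
    proof
      assume "(S / real d) powr q = 1 / B"
      then have "(1 / B) powr (1 / q) = ((S / real d) powr q) powr (1 / q)" by simp
      then show "S / real d = (1 / B) powr (1 / q)"
        using q that assms by (simp add: powr_powr)
    qed (use q B in \<open>simp add: powr_powr\<close>)
    also have "\<dots> \<longleftrightarrow> S = R"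
      using assms by (simp add: R_def inv field_simps)
    finally show ?thesis .
  qed
  have sol: "free_boundary_solution d p (profile d p R) R"
    using profile_solution[OF assms R] profile_0[OF assms R] normalized[OF R]
    by (simp add: q_def B_def)
  have uniq: "S = R \<and> (\<forall>r\<in>{0..R}. v r = profile d p R r)"
    if v: "free_boundary_solution d p v S" for v S
  proof -
    have S: "0 < S" "v 0 = 1" using v by (auto simp: free_boundary_solution_def)
    have eq: "\<forall>r\<in>{0..S}. v r = profile d p S r"
      by (rule solution_eq_profile[OF assms S(1) v])
    \<comment> \<open>Evaluating at \<open>0\<close> shows that any solution's radius satisfies the
      normalization equation.\<close>
    then have "profile d p S 0 = 1" using S by auto
    then have "S = R"
      using profile_0[OF assms S(1)] normalized[OF S(1)] by (simp add: q_def B_def)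
    with eq show ?thesis by simp
  qed
  show ?thesis
    by (intro exI[of _ "profile d p R"] exI[of _ R] conjI sol)
      (use uniq in \<open>auto simp: profile_def R_def B_def q_def\<close>)
qed

end
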